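(* Let $\lambda>0$, $p,q,r\in[1,\infty]$, and $\mathcal{U}_{(q,r)}=\{\boldsymbol\Delta\in\mathbb{R}^{m\times n}:\|\boldsymbol\Delta\|_{(q,r)}\le\lambda\}$. For any $\mathbf{z}\in\mathbb{R}^m$ and $\boldsymbol\beta\in\mathbb{R}^n$, $$\max_{\boldsymbol\Delta\in\mathcal{U}_{(q,r)}} \|\mathbf{z}+\boldsymbol\Delta\boldsymbol\beta\|_p \leq \|\mathbf{z}\|_p + \lambda\,\delta_m(p,r)\|\boldsymbol\beta\|_{q}.\qquad(\mathrm{UB})$$ In particular, if $p\in\{1,r,\infty\}$, there is equality in (UB) for all $(\mathbf{z},\boldsymbol\beta)$. If $p\in(1,\infty)$, $p\neq r$ and $m\ge2$, then for any $\boldsymbol\beta\neq\mathbf{0}$ the inequality in (UB) is strict for almost all $\mathbf{z}$. Further, for $p\in(1,\infty)$ with $p\neq r$ one has, for all $\mathbf{z},\boldsymbol\beta$, the lower bound $$\|\mathbf{z}\|_p + \frac{\lambda}{\delta_m(r,p)}\|\boldsymbol\beta\|_{q}\leq\max_{\boldsymbol\Delta\in\mathcal{U}_{(q,r)}} \|\mathbf{z}+\boldsymbol\Delta\boldsymbol\beta\|_p,$$ whose gap is arbitrarily small for all $\boldsymbol\beta$; that is, for every $\boldsymbol\beta\in\mathbb{R}^n$ the infimum over $\mathbf{z}\in\mathbb{R}^m$ of the right side minus the left side equals $0$.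
   Context: $\|\cdot\|_p$ is the $\ell_p$ norm. $\|\boldsymbol\Delta\|_{(q,r)}:=\max_{\boldsymbol\beta\in\mathbb{R}^n,\,\boldsymbol\beta\neq0}\|\boldsymbol\Delta\boldsymbol\beta\|_r/\|\boldsymbol\beta\|_q$ is the induced norm of $\boldsymbol\Delta\in\mathbb{R}^{m\times n}$ as a map from $(\mathbb{R}^n,\ell_q)$ to $(\mathbb{R}^m,\ell_r)$. For $a,b\in[1,\infty]$, $\delta_m(a,b):=\max\{\|\mathbf{u}\|_a:\mathbf{u}\in\mathbb{R}^m,\ \|\mathbf{u}\|_b=1\}$. "Almost all" is with respect to Lebesgue measure on $\mathbb{R}^m$. *)

theory Defs
  imports "HOL-Analysis.Analysis" "HOL-Library.Extended_Real"
begin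

text \<open>Exponents range over \<open>[1, \<infinity>]\<close> and are represented as extended reals \<open>p \<ge> 1\<close>.\<close>

definition lp_norm :: "ereal \<Rightarrow> real ^ 'k \<Rightarrow> real" where
  "lp_norm p x =
     (if p = \<infinity> then infnorm x
      else (\<Sum>i\<in>UNIV. \<bar>x $ i\<bar> powr real_of_ereal p) powr (1 / real_of_ereal p))"

text \<open>The maximum of a real function over an arbitrary set (\<open>Max\<close> is for finite sets only). It is
  meaningful only when the maximum is attained, which is proved below for every use.\<close>

definition max_over :: "'a set \<Rightarrow> ('a \<Rightarrow> real) \<Rightarrow> real" where
  "max_over A f = (GREATEST v. v \<in> f ` A)"

definition induced_norm :: "ereal \<Rightarrow> ereal \<Rightarrow> real ^ 'n ^ 'm \<Rightarrow> real" where
  "induced_norm q r D = max_over {b. b \<noteq> 0} (\<lambda>b. lp_norm r (D *v b) / lp_norm q b)"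

definition uncertainty_set :: "real \<Rightarrow> ereal \<Rightarrow> ereal \<Rightarrow> (real ^ 'n ^ 'm) set" where
  "uncertainty_set l q r = {D. induced_norm q r D \<le> l}"

text \<open>The dimension \<open>m\<close> enters as the cardinality of the index type \<open>'m\<close>.\<close>

definition delta :: "'m::finite itself \<Rightarrow> ereal \<Rightarrow> ereal \<Rightarrow> real" where
  "delta _ a b = max_over {u :: real ^ 'm. lp_norm b u = 1} (lp_norm a)"


definition robust_max ::
    "real \<Rightarrow> ereal \<Rightarrow> ereal \<Rightarrow> ereal \<Rightarrow> real ^ 'm \<Rightarrow> real ^ 'n \<Rightarrow> real" where
  "robust_max l p q r z b =
     max_over (uncertainty_set l q r :: (real ^ 'n ^ 'm) set) (\<lambda>D. lp_norm p (z + D *v b))"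


subsection \<open>All maxima are attained\<close>

lemma max_over_eqI:
  assumes "x \<in> A" "\<And>y. y \<in> A \<Longrightarrow> f y \<le> f x"
  shows "max_over A f = f x"
  unfolding max_over_def by (rule Greatest_equality) (use assms in auto)

lemma ereal_ge1_cases:
  assumes "1 \<le> (p::ereal)"
  obtains "p = \<infinity>" | s where "p = ereal s" "1 \<le> s"
  using assms by (cases p) auto

lemma continuous_on_lp_norm:
  assumes "1 \<le> p"
  shows "continuous_on S (lp_norm p)"
proof (cases rule: ereal_ge1_cases[OF assms])
  case 1
  then show ?thesis
    using continuous_on_infnorm[OF continuous_on_id, of S] by (simp add: lp_norm_def[abs_def])
next
  case (2 s)
  have "continuous_on S (\<lambda>x::real^'a. (\<Sum>i\<in>UNIV. \<bar>x $ i\<bar> powr s) powr (1 / s))"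
    using 2 by (intro continuous_on_powr' continuous_intros) (auto intro!: sum_nonneg)
  with 2 show ?thesis by (simp add: lp_norm_def[abs_def])
qed

lemma continuous_on_lp_norm_compose:
  assumes "1 \<le> p" "continuous_on S f"
  shows "continuous_on S (\<lambda>x. lp_norm p (f x))"
  using continuous_on_compose[OF assms(2) continuous_on_lp_norm[OF assms(1)]]
  by (simp add: o_def)

lemma lp_norm_nonneg: "0 \<le> lp_norm p x"
  by (simp add: lp_norm_def infnorm_pos_le)

lemma component_le_lp_norm:
  assumes "1 \<le> p"
  shows "\<bar>x $ i\<bar> \<le> lp_norm p x"
proof (cases rule: ereal_ge1_cases[OF assms])
  case 1
  then show ?thesis by (simp add: lp_norm_def component_le_infnorm_cart)
next
  case (2 s)
  have "\<bar>x $ i\<bar> powr s \<le> (\<Sum>i\<in>UNIV. \<bar>x $ i\<bar> powr s)"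
    by (rule member_le_sum) auto
  then have "(\<bar>x $ i\<bar> powr s) powr (1/s) \<le> (\<Sum>i\<in>UNIV. \<bar>x $ i\<bar> powr s) powr (1/s)"
    using 2 by (intro powr_mono2) auto
  then show ?thesis using 2 by (simp add: lp_norm_def powr_powr)
qed

lemma lp_norm_zero: "lp_norm p 0 = 0"
  by (simp add: lp_norm_def infnorm_0)

lemma lp_norm_eq_0_iff:
  assumes "1 \<le> p"
  shows "lp_norm p x = 0 \<longleftrightarrow> x = 0"
proof
  assume "lp_norm p x = 0"
  then have "\<bar>x $ i\<bar> \<le> 0" for i
    using component_le_lp_norm[OF assms, of x i] by simp
  then show "x = 0" by (simp add: vec_eq_iff)
qed (simp add: lp_norm_zero)

lemma lp_norm_scaleR:
  assumes "1 \<le> p"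
  shows "lp_norm p (c *\<^sub>R x) = \<bar>c\<bar> * lp_norm p x"
proof (cases rule: ereal_ge1_cases[OF assms])
  case 1
  then show ?thesis by (simp add: lp_norm_def infnorm_mul)
next
  case (2 s)
  then show ?thesis
    by (simp add: lp_norm_def abs_mult powr_mult powr_powr sum_nonneg
        flip: sum_distrib_left)
qed

lemma delta_attained:
  fixes m :: "'m::finite itself"
  assumes "1 \<le> a" "1 \<le> b"
  shows "\<exists>u :: real ^ 'm. lp_norm b u = 1 \<and> delta m a b = lp_norm a u \<and>
           (\<forall>v :: real ^ 'm. lp_norm b v = 1 \<longrightarrow> lp_norm a v \<le> lp_norm a u)"
proof -
  let ?S = "{u :: real ^ 'm. lp_norm b u = 1}"
  have "closed ?S"
    by (intro closed_Collect_eq continuous_on_lp_norm assms continuous_on_const)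
  moreover have "bounded ?S"
  proof (rule boundedI)
    fix u :: "real ^ 'm" assume "u \<in> ?S"
    then have "(\<Sum>i\<in>UNIV. \<bar>u $ i\<bar>) \<le> (\<Sum>i\<in>(UNIV::'m set). 1)"
      using component_le_lp_norm[OF assms(2), of u] by (intro sum_mono) auto
    then show "norm u \<le> (\<Sum>i\<in>(UNIV::'m set). 1)"
      using norm_le_l1_cart[of u] by linarith
  qed
  ultimately have "compact ?S" by (simp add: compact_eq_bounded_closed)
  moreover have "?S \<noteq> {}"
  proof -
    have "lp_norm b (1 :: real ^ 'm) \<noteq> 0"
      using lp_norm_eq_0_iff[OF assms(2), of "1 :: real ^ 'm"] by simp
    then have "(1 / lp_norm b (1 :: real^'m)) *\<^sub>R (1 :: real^'m) \<in> ?S"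
      using lp_norm_nonneg[of b "1 :: real^'m"]
      by (simp add: lp_norm_scaleR assms del: scaleR_one)
    then show ?thesis by blast
  qed
  ultimately obtain u where "u \<in> ?S" "\<forall>v\<in>?S. lp_norm a v \<le> lp_norm a u"
    using continuous_attains_sup[of ?S "lp_norm a"] continuous_on_lp_norm[OF assms(1)]
    by blast
  then show ?thesis
    unfolding delta_def using max_over_eqI[of u ?S "lp_norm a"] by blast
qed

lemma induced_norm_attained:
  fixes D :: "real ^ 'n ^ 'm"
  assumes "1 \<le> q" "1 \<le> r"
  shows "\<exists>b. b \<noteq> 0 \<and> induced_norm q r D = lp_norm r (D *v b) / lp_norm q b \<and>
           (\<forall>c. c \<noteq> 0 \<longrightarrow> lp_norm r (D *v c) / lp_norm q c \<le> lp_norm r (D *v b) / lp_norm q b)"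
proof -
  let ?f = "\<lambda>b. lp_norm r (D *v b) / lp_norm q b"
  let ?S = "sphere (0 :: real ^ 'n) 1"
  have "continuous_on ?S ?f"
    by (intro continuous_on_divide continuous_on_lp_norm_compose assms
        matrix_vector_mult_linear_continuous_on continuous_on_lp_norm)
       (auto simp: lp_norm_eq_0_iff assms)
  moreover have "?S \<noteq> {}" by simp
  ultimately obtain b where b: "b \<in> ?S" "\<forall>c\<in>?S. ?f c \<le> ?f b"
    using continuous_attains_sup[of ?S ?f] by auto
  have le: "?f c \<le> ?f b" if "c \<noteq> 0" for c
  proof -
    have "?f ((1 / norm c) *\<^sub>R c) = ?f c"
      using that by (simp add: matrix_vector_mult_scaleR lp_norm_scaleR assms)
    moreover have "(1 / norm c) *\<^sub>R c \<in> ?S" using that by simp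
    ultimately show ?thesis using b(2) by metis
  qed
  have "b \<noteq> 0" using b(1) by auto
  then show ?thesis
    unfolding induced_norm_def using le max_over_eqI[of b "{b. b \<noteq> 0}" ?f] by blast
qed

lemma uncertainty_set_iff:
  assumes "1 \<le> q" "1 \<le> r"
  shows "D \<in> uncertainty_set l q r \<longleftrightarrow> (\<forall>b. lp_norm r (D *v b) \<le> l * lp_norm q b)"
proof -
  obtain b0 where b0: "b0 \<noteq> 0" "induced_norm q r D = lp_norm r (D *v b0) / lp_norm q b0"
    and le: "\<And>c. c \<noteq> 0 \<Longrightarrow> lp_norm r (D *v c) / lp_norm q c \<le> lp_norm r (D *v b0) / lp_norm q b0"
    using induced_norm_attained[OF assms, of D] by blast
  have pos: "0 < lp_norm q b" if "b \<noteq> 0" for b :: "real ^ 'a"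
    using that lp_norm_nonneg[of q b] lp_norm_eq_0_iff[OF assms(1), of b] by linarith
  have "lp_norm r (D *v b) \<le> l * lp_norm q b" if "induced_norm q r D \<le> l" for b
  proof (cases "b = 0")
    case False
    then have "lp_norm r (D *v b) / lp_norm q b \<le> l" using le[OF False] b0 that by linarith
    then show ?thesis using pos[OF False] by (simp add: divide_le_eq)
  qed (simp add: lp_norm_zero)
  moreover have "induced_norm q r D \<le> l" if "\<forall>b. lp_norm r (D *v b) \<le> l * lp_norm q b"
    using that b0 pos[OF b0(1)] by (simp add: divide_le_eq)
  ultimately show ?thesis by (auto simp: uncertainty_set_def)
qed

lemma compact_uncertainty_set:
  assumes "1 \<le> q" "1 \<le> r"
  shows "compact (uncertainty_set l q r :: (real ^ 'n ^ 'm) set)"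
proof -
  let ?U = "uncertainty_set l q r :: (real ^ 'n ^ 'm) set"
  have U: "?U = {D. \<forall>b. lp_norm r (D *v b) \<le> l * lp_norm q b}"
    using uncertainty_set_iff[OF assms] by blast
  have "continuous_on UNIV (\<lambda>D :: real ^ 'n ^ 'm. D *v b)" for b
    unfolding matrix_vector_mult_def by (intro continuous_intros)
  then have "closed ?U"
    unfolding U
    by (intro closed_Collect_all closed_Collect_le continuous_on_lp_norm_compose assms
        continuous_on_const)
  moreover have "bounded ?U"
  proof (rule boundedI)
    fix D assume D: "D \<in> ?U"
    have entry: "\<bar>D $ i $ j\<bar> \<le> l * lp_norm q (axis j 1 :: real ^ 'n)" for i j
    proof -
      have "D $ i $ j = (D *v axis j 1) $ i"
        by (simp add: matrix_vector_mult_basis column_def)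
      then show ?thesis
        using D component_le_lp_norm[OF assms(2), of "D *v axis j 1" i] unfolding U
        by (metis (mono_tags, lifting) mem_Collect_eq order_trans)
    qed
    have "norm D \<le> (\<Sum>i\<in>UNIV. norm (D $ i))"
      unfolding norm_vec_def by (rule L2_set_le_sum) simp
    also have "\<dots> \<le> (\<Sum>i\<in>UNIV. \<Sum>j\<in>UNIV. \<bar>D $ i $ j\<bar>)"
      by (intro sum_mono norm_le_l1_cart)
    also have "\<dots> \<le> (\<Sum>i\<in>(UNIV::'m set). \<Sum>j\<in>UNIV. l * lp_norm q (axis j 1 :: real ^ 'n))"
      by (intro sum_mono entry)
    finally show "norm D \<le> (\<Sum>i\<in>(UNIV::'m set). \<Sum>j\<in>UNIV. l * lp_norm q (axis j 1 :: real ^ 'n))" .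
  qed
  ultimately show ?thesis by (simp add: compact_eq_bounded_closed)
qed

lemma robust_max_attained:
  fixes z :: "real ^ 'm" and b :: "real ^ 'n"
  assumes "0 \<le> l" "1 \<le> p" "1 \<le> q" "1 \<le> r"
  shows "\<exists>D\<in>uncertainty_set l q r. robust_max l p q r z b = lp_norm p (z + D *v b) \<and>
           (\<forall>E\<in>uncertainty_set l q r. lp_norm p (z + E *v b) \<le> lp_norm p (z + D *v b))"
proof -
  let ?U = "uncertainty_set l q r :: (real ^ 'n ^ 'm) set"
  let ?f = "\<lambda>D :: real ^ 'n ^ 'm. lp_norm p (z + D *v b)"
  have "continuous_on ?U ?f"
    unfolding matrix_vector_mult_def
    by (intro continuous_on_lp_norm_compose assms continuous_intros)
  moreover have "compact ?U" by (rule compact_uncertainty_set) fact+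
  moreover have "0 \<in> ?U"
    using assms by (simp add: uncertainty_set_iff lp_norm_zero lp_norm_nonneg)
  ultimately obtain D where "D \<in> ?U" "\<forall>E\<in>?U. ?f E \<le> ?f D"
    using continuous_attains_sup[of ?U ?f] by blast
  then show ?thesis unfolding robust_max_def using max_over_eqI[of D ?U ?f] by blast
qed

end

theory Submission
  imports Defs
begin

text \<open>
  A vector \<open>g\<close> with \<open>g \<bullet> b = \<parallel>b\<parallel>\<^sub>q\<close> and \<open>g \<bullet> x \<le> \<parallel>x\<parallel>\<^sub>q\<close> turns every \<open>w\<close> with \<open>\<parallel>w\<parallel>\<^sub>r \<le> l \<parallel>b\<parallel>\<^sub>q\<close> into
  an admissible rank one matrix mapping \<open>b\<close> to \<open>w\<close>. The robust maximum is therefore the maximum of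
  \<open>\<parallel>z + w\<parallel>\<^sub>p\<close> over the \<open>r\<close>-ball of radius \<open>l \<parallel>b\<parallel>\<^sub>q\<close>, and the upper bound is the triangle
  inequality. For \<open>1 < p < \<infinity>\<close> the \<open>p\<close>-norm is strictly convex, so equality forces \<open>z\<close> to be a multiple
  of a maximizer in the definition of \<open>\<delta>(p, r)\<close>. For \<open>p \<noteq> r\<close> such a maximizer has at most one
  nonzero coordinate (\<open>p > r\<close>) or all coordinates of the same absolute value (\<open>p < r\<close>), which
  confines \<open>z\<close> to finitely many hyperplanes if \<open>m \<ge> 2\<close>. The lower bound comes from \<open>w\<close> parallel to \<open>z\<close>.
  Its gap tends to 0 along large multiples of a maximizer of \<open>\<delta>(r, p)\<close>, a unit vector or the vector
  of ones, because there the gradient of the \<open>p\<close>-norm has \<open>r\<close>-dual norm \<open>1 / \<delta>(r, p)\<close>.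
\<close>

subsection \<open>Scalar inequalities\<close>

text \<open>Concavity of the power, with the tangent at 1. The strict form feeds the equality cases
  of Young's inequality and of the power mean inequality.\<close>

lemma powr_le_tangent:
  fixes a t :: real
  assumes "0 \<le> a" "0 < t" "t < 1"
  shows "a powr t \<le> 1 + t * (a - 1)" and "a \<noteq> 1 \<Longrightarrow> a powr t < 1 + t * (a - 1)"
proof -
  show strict: "a powr t < 1 + t * (a - 1)" if "a \<noteq> 1"
  proof (cases "a = 0")
    case False
    with assms have a: "0 < a" by simp
    \<comment> \<open>\<open>b\<close> is the weighted mean of \<open>a\<close> and 1. In the bounds
      \<open>ln x \<le> x - 1\<close> at \<open>a / b\<close> and \<open>1 / b\<close> the weighted
      right sides then cancel.\<close>
    define b where "b = t * a + (1 - t)"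
    have b: "0 < b" unfolding b_def using a assms by (simp add: add_pos_pos)
    have "a - b = (1 - t) * (a - 1)" by (simp add: b_def algebra_simps)
    then have ab: "a \<noteq> b" using that assms by auto
    have "ln (a / b) < a / b - 1"
      using a b ab ln_le_minus_one[of "a / b"] ln_eq_minus_one[of "a / b"]
      by (auto simp: less_le)
    moreover have "ln (1 / b) \<le> 1 / b - 1" using b by (intro ln_le_minus_one) simp
    ultimately have "t * ln (a / b) + (1 - t) * ln (1 / b) < t * (a / b - 1) + (1 - t) * (1 / b - 1)"
      using assms by (intro add_less_le_mono mult_strict_left_mono mult_left_mono) auto
    also have "\<dots> = (t * a + (1 - t)) / b - 1" using b by (simp add: field_simps)
    also have "\<dots> = 0" using b by (simp add: b_def[symmetric])
    finally have "ln (a powr t) < ln b"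
      using a b by (simp add: ln_div ln_powr algebra_simps)
    then have "a powr t < b" using a b by (subst (asm) ln_less_cancel_iff) auto
    then show ?thesis by (simp add: b_def algebra_simps)
  qed (use assms in simp)
  show "a powr t \<le> 1 + t * (a - 1)" by (cases "a = 1") (use strict in auto)
qed

text \<open>Young's inequality for \<open>y\<close> and \<open>\<bar>c\<bar> powr (s - 1)\<close>. The left side carries the sign of \<open>c\<close>, so
  that equality forces \<open>y = c\<close> and not only \<open>\<bar>y\<bar> = \<bar>c\<bar>\<close>; for \<open>s = 1\<close> and \<open>c = 0\<close> the factor
  \<open>sgn c\<close> makes the value of \<open>0 powr 0\<close> irrelevant.\<close>

lemma young_signed:
  fixes c y s :: real
  assumes "1 \<le> s"
  shows "sgn c * \<bar>c\<bar> powr (s - 1) * y \<le> \<bar>y\<bar> powr s / s + (1 - 1 / s) * \<bar>c\<bar> powr s"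
    and "1 < s \<Longrightarrow> y \<noteq> c \<Longrightarrow>
      sgn c * \<bar>c\<bar> powr (s - 1) * y < \<bar>y\<bar> powr s / s + (1 - 1 / s) * \<bar>c\<bar> powr s"
proof -
  have le_abs: "sgn c * \<bar>c\<bar> powr (s - 1) * y \<le> \<bar>c\<bar> powr (s - 1) * \<bar>y\<bar>"
  proof -
    have "sgn c * y \<le> \<bar>y\<bar>" by (auto simp: sgn_if)
    then show ?thesis
      using mult_left_mono[of "sgn c * y" "\<bar>y\<bar>" "\<bar>c\<bar> powr (s - 1)"] by (simp add: ac_simps)
  qed
  have young: "\<bar>c\<bar> powr (s - 1) * \<bar>y\<bar> \<le> \<bar>y\<bar> powr s / s + (1 - 1 / s) * \<bar>c\<bar> powr s \<and>
      (\<bar>y\<bar> \<noteq> \<bar>c\<bar> \<longrightarrow>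
        \<bar>c\<bar> powr (s - 1) * \<bar>y\<bar> < \<bar>y\<bar> powr s / s + (1 - 1 / s) * \<bar>c\<bar> powr s)"
    if s: "1 < s"
  proof (cases "c = 0")
    case False
    \<comment> \<open>With this \<open>a\<close> the tangent inequality for the exponent
      \<open>1 / s\<close>, multiplied by \<open>\<bar>c\<bar> powr s\<close>, is Young's
      inequality.\<close>
    define a where "a = (\<bar>y\<bar> / \<bar>c\<bar>) powr s"
    have a: "a powr (1 / s) = \<bar>y\<bar> / \<bar>c\<bar>" using s by (simp add: a_def powr_powr)
    have C: "0 < \<bar>c\<bar> powr s" using False by simp
    have c1: "\<bar>c\<bar> powr (s - 1) = \<bar>c\<bar> powr s / \<bar>c\<bar>" using False by (simp add: powr_diff)
    have aC: "a * \<bar>c\<bar> powr s = \<bar>y\<bar> powr s"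
      using False by (simp add: a_def powr_divide)
    have lhs: "\<bar>c\<bar> powr s * a powr (1 / s) = \<bar>c\<bar> powr (s - 1) * \<bar>y\<bar>"
      by (simp add: a c1)
    have rhs: "\<bar>c\<bar> powr s * (1 + 1 / s * (a - 1)) = \<bar>y\<bar> powr s / s + (1 - 1 / s) * \<bar>c\<bar> powr s"
      by (simp add: aC[symmetric] algebra_simps add_divide_distrib diff_divide_distrib)
    have "a powr (1 / s) \<le> 1 + 1 / s * (a - 1)"
      using s by (intro powr_le_tangent) (auto simp: a_def)
    then have "\<bar>c\<bar> powr s * a powr (1 / s) \<le> \<bar>c\<bar> powr s * (1 + 1 / s * (a - 1))"
      by (rule mult_left_mono) simp
    moreover have "\<bar>c\<bar> powr s * a powr (1 / s) < \<bar>c\<bar> powr s * (1 + 1 / s * (a - 1))"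
      if "\<bar>y\<bar> \<noteq> \<bar>c\<bar>"
    proof -
      have "a \<noteq> 1" using that False a by auto
      then have "a powr (1 / s) < 1 + 1 / s * (a - 1)"
        using s by (intro powr_le_tangent) (auto simp: a_def)
      then show ?thesis using C by (rule mult_strict_left_mono)
    qed
    ultimately show ?thesis unfolding lhs rhs by blast
  qed (use s in auto)
  show "sgn c * \<bar>c\<bar> powr (s - 1) * y \<le> \<bar>y\<bar> powr s / s + (1 - 1 / s) * \<bar>c\<bar> powr s"
  proof (cases "s = 1")
    case True
    then show ?thesis using le_abs by (auto simp: powr_def split: if_splits)
  next
    case False
    with assms have "1 < s" by simp
    then show ?thesis using young le_abs by linarith
  qed
  show "sgn c * \<bar>c\<bar> powr (s - 1) * y < \<bar>y\<bar> powr s / s + (1 - 1 / s) * \<bar>c\<bar> powr s"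
    if s: "1 < s" and "y \<noteq> c"
  proof (cases "\<bar>y\<bar> = \<bar>c\<bar>")
    case True
    with \<open>y \<noteq> c\<close> have y: "y = - c" "c \<noteq> 0" by linarith+
    then have "sgn c * y < 0" by (auto simp: sgn_if)
    moreover have "0 < \<bar>c\<bar> powr (s - 1)" using y by simp
    ultimately have "sgn c * y * \<bar>c\<bar> powr (s - 1) < 0" by (rule mult_neg_pos)
    then have "sgn c * \<bar>c\<bar> powr (s - 1) * y < 0" by (simp add: ac_simps)
    also have "0 \<le> \<bar>y\<bar> powr s / s + (1 - 1 / s) * \<bar>c\<bar> powr s" using s by simp
    finally show ?thesis .
  next
    case False
    then show ?thesis using young[OF s] le_abs by linarith
  qed
qed

subsection \<open>Norming functionals and strict convexity\<close>

lemma lp_norm_powr: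
  assumes "1 \<le> s"
  shows "lp_norm (ereal s) x powr s = (\<Sum>i\<in>UNIV. \<bar>x $ i\<bar> powr s)"
  using assms by (simp add: lp_norm_def powr_powr sum_nonneg)

lemma lp_norm_le_iff:
  assumes "1 \<le> s" "0 \<le> c"
  shows "lp_norm (ereal s) x \<le> c \<longleftrightarrow> (\<Sum>i\<in>UNIV. \<bar>x $ i\<bar> powr s) \<le> c powr s"
  unfolding lp_norm_powr[OF assms(1), symmetric]
  using assms lp_norm_nonneg[of "ereal s" x] powr_less_mono2[of s c "lp_norm (ereal s) x"]
    powr_mono2[of s "lp_norm (ereal s) x" c]
  by (smt (verit))

lemma lp_norm_less_iff:
  assumes "1 \<le> s" "0 \<le> c"
  shows "lp_norm (ereal s) x < c \<longleftrightarrow> (\<Sum>i\<in>UNIV. \<bar>x $ i\<bar> powr s) < c powr s"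
  unfolding lp_norm_powr[OF assms(1), symmetric]
  using assms lp_norm_nonneg[of "ereal s" x] powr_less_mono2[of s "lp_norm (ereal s) x" c]
    powr_mono2[of s c "lp_norm (ereal s) x"]
  by (smt (verit))

lemma infnorm_attained_cart: "\<exists>i. infnorm x = \<bar>x $ i\<bar>" for x :: "real ^ 'k"
proof -
  have "finite (range (\<lambda>i. \<bar>x $ i\<bar>))" "range (\<lambda>i. \<bar>x $ i\<bar>) \<noteq> {}" by auto
  then have "Sup (range (\<lambda>i. \<bar>x $ i\<bar>)) \<in> range (\<lambda>i. \<bar>x $ i\<bar>)"
    using Max_in cSup_eq_Max by metis
  then show ?thesis by (auto simp: infnorm_cart full_SetCompr_eq)
qed

lemma lp_norm_pos_iff: "1 \<le> p \<Longrightarrow> 0 < lp_norm p x \<longleftrightarrow> x \<noteq> 0"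
  using lp_norm_nonneg[of p x] lp_norm_eq_0_iff[of p x] by linarith

lemma lp_norm_normalize: "1 \<le> p \<Longrightarrow> x \<noteq> 0 \<Longrightarrow> lp_norm p ((1 / lp_norm p x) *\<^sub>R x) = 1"
  using lp_norm_pos_iff[of p x] by (simp add: lp_norm_scaleR)

text \<open>\<open>g\<close> is the gradient of the norm at \<open>b\<close>, a subgradient if
  \<open>s = 1\<close>. Young's inequality, summed over the coordinates of two unit vectors, bounds
  \<open>g\<close> by \<open>1 / s + (1 - 1 / s) = 1\<close>; strictness in one coordinate gives
  uniqueness.\<close>

lemma norming_functional_finite:
  fixes b :: "real ^ 'k"
  assumes "1 \<le> s" "b \<noteq> 0"
  defines "p \<equiv> ereal s"
  shows "\<exists>g. g \<bullet> b = lp_norm p b \<and> (\<forall>x. g \<bullet> x \<le> lp_norm p x) \<and>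
    (1 < s \<longrightarrow> (\<forall>x. g \<bullet> x = lp_norm p x \<longrightarrow> x = (lp_norm p x / lp_norm p b) *\<^sub>R b))"
proof -
  have p: "1 \<le> p" using assms by simp
  define c where "c = (1 / lp_norm p b) *\<^sub>R b"
  define g :: "real ^ 'k" where "g = (\<chi> i. sgn (c $ i) * \<bar>c $ i\<bar> powr (s - 1))"
  have sum1: "(\<Sum>i\<in>UNIV. \<bar>u $ i\<bar> powr s) = 1" if "lp_norm p u = 1" for u :: "real ^ 'k"
    using lp_norm_powr[OF assms(1), of u] that by (simp add: p_def)
  have c1: "lp_norm p c = 1" unfolding c_def by (rule lp_norm_normalize[OF p assms(2)])
  have "g \<bullet> c = (\<Sum>i\<in>UNIV. \<bar>c $ i\<bar> powr s)"
    unfolding inner_vec_def g_def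
    by (intro sum.cong) (auto simp: sgn_if powr_diff field_simps)
  then have gc: "g \<bullet> c = 1" using sum1[OF c1] by simp
  have bc: "b = lp_norm p b *\<^sub>R c"
    using lp_norm_pos_iff[OF p, of b] assms(2) by (simp add: c_def)
  have gb: "g \<bullet> b = lp_norm p b" by (subst bc) (simp add: gc)
  have bound: "g \<bullet> y \<le> 1 \<and> (1 < s \<longrightarrow> y \<noteq> c \<longrightarrow> g \<bullet> y < 1)" if y: "lp_norm p y = 1" for y
  proof -
    let ?r = "\<lambda>i. \<bar>y $ i\<bar> powr s / s + (1 - 1 / s) * \<bar>c $ i\<bar> powr s"
    have "(\<Sum>i\<in>UNIV. ?r i) = (\<Sum>i\<in>UNIV. \<bar>y $ i\<bar> powr s) / s + (1 - 1 / s) * (\<Sum>i\<in>UNIV. \<bar>c $ i\<bar> powr s)"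
      by (simp add: sum.distrib sum_distrib_left sum_divide_distrib)
    then have r: "(\<Sum>i\<in>UNIV. ?r i) = 1" by (simp add: sum1 y c1)
    have le: "g $ i * y $ i \<le> ?r i" for i
      unfolding g_def using young_signed(1)[OF assms(1)] by simp
    then have "g \<bullet> y \<le> (\<Sum>i\<in>UNIV. ?r i)"
      unfolding inner_vec_def by (auto intro!: sum_mono)
    moreover have "g \<bullet> y < (\<Sum>i\<in>UNIV. ?r i)" if "1 < s" "y \<noteq> c"
    proof -
      obtain i where "y $ i \<noteq> c $ i" using \<open>y \<noteq> c\<close> by (auto simp: vec_eq_iff)
      then have "g $ i * y $ i < ?r i"
        unfolding g_def using young_signed(2)[OF assms(1) \<open>1 < s\<close>] by simp
      then show ?thesis
        unfolding inner_vec_def inner_real_def using le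
        by (intro sum_strict_mono_ex1) auto
    qed
    ultimately show ?thesis by (simp add: r)
  qed
  have scaled: "g \<bullet> x = lp_norm p x * (g \<bullet> ((1 / lp_norm p x) *\<^sub>R x))" if "x \<noteq> 0" for x
    using that lp_norm_pos_iff[OF p, of x] by simp
  have le: "g \<bullet> x \<le> lp_norm p x" for x
  proof (cases "x = 0")
    case False
    then show ?thesis
      unfolding scaled[OF False] using bound[OF lp_norm_normalize[OF p False]]
      by (simp add: mult_left_le lp_norm_nonneg del: inner_scaleR_right)
  qed (simp add: lp_norm_nonneg)
  moreover have "x = (lp_norm p x / lp_norm p b) *\<^sub>R b" if s: "1 < s" and eq: "g \<bullet> x = lp_norm p x" for x
  proof (cases "x = 0")
    case False
    have "g \<bullet> ((1 / lp_norm p x) *\<^sub>R x) = 1"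
      using eq False lp_norm_pos_iff[OF p, of x] by simp
    then have "(1 / lp_norm p x) *\<^sub>R x = c"
      using bound[OF lp_norm_normalize[OF p False]] s by force
    then have "x = lp_norm p x *\<^sub>R c"
      using False lp_norm_pos_iff[OF p, of x] by auto
    then show ?thesis by (simp add: c_def)
  qed (simp add: lp_norm_zero)
  ultimately show ?thesis using gb by blast
qed

lemma norming_functional:
  fixes b :: "real ^ 'k"
  assumes "1 \<le> p"
  obtains g where "g \<bullet> b = lp_norm p b" "\<And>x. g \<bullet> x \<le> lp_norm p x"
proof (cases rule: ereal_ge1_cases[OF assms])
  case 1
  \<comment> \<open>At infinity the functional reads off, with its sign, a coordinate of largest
    absolute value.\<close>
  obtain i where i: "infnorm b = \<bar>b $ i\<bar>" using infnorm_attained_cart by blast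
  have inner: "axis i (sgn (b $ i)) \<bullet> x = sgn (b $ i) * x $ i" for x :: "real ^ 'k"
    by (simp add: inner_axis')
  show ?thesis
  proof
    show "axis i (sgn (b $ i)) \<bullet> b = lp_norm p b"
      using 1 i by (simp add: inner lp_norm_def abs_sgn mult.commute)
    show "axis i (sgn (b $ i)) \<bullet> x \<le> lp_norm p x" for x
      using component_le_lp_norm[OF assms, of x i] unfolding inner by (auto simp: sgn_if)
  qed
next
  case (2 s)
  then show ?thesis
  proof (cases "b = 0")
    case True
    then show ?thesis using that[of 0] by (simp add: lp_norm_zero lp_norm_nonneg)
  next
    case False
    then show ?thesis using norming_functional_finite[OF 2(2) False] that 2(1) by blast
  qed
qed

text \<open>A functional norming \<open>x + y\<close> is at most the norm on either summand; this
  gives Minkowski's inequality.\<close>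

lemma lp_norm_triangle:
  fixes x y :: "real ^ 'k"
  assumes "1 \<le> p"
  shows "lp_norm p (x + y) \<le> lp_norm p x + lp_norm p y"
proof -
  obtain g where "g \<bullet> (x + y) = lp_norm p (x + y)" "\<And>x. g \<bullet> x \<le> lp_norm p x"
    using norming_functional[OF assms] by metis
  then show ?thesis by (metis add_mono inner_add_right)
qed

text \<open>Equality forces the functional norming \<open>x + y\<close> to norm both summands, and
  uniqueness makes both multiples of \<open>x + y\<close>.\<close>

lemma lp_norm_triangle_eqD:
  fixes x y :: "real ^ 'k"
  assumes "1 < p" "p < \<infinity>" "lp_norm p (x + y) = lp_norm p x + lp_norm p y" "y \<noteq> 0"
  shows "\<exists>c. x = c *\<^sub>R y"
proof -
  obtain s where s: "p = ereal s" "1 < s" using assms(1,2) by (cases p) auto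
  then have p: "1 \<le> p" by simp
  have "0 < lp_norm p (x + y)"
    using assms(3,4) lp_norm_pos_iff[OF p, of y] lp_norm_nonneg[of p x] by simp
  then have xy: "x + y \<noteq> 0" using lp_norm_pos_iff[OF p] by blast
  obtain g where g: "g \<bullet> (x + y) = lp_norm p (x + y)" "\<And>u. g \<bullet> u \<le> lp_norm p u"
    "\<And>u. g \<bullet> u = lp_norm p u \<Longrightarrow> u = (lp_norm p u / lp_norm p (x + y)) *\<^sub>R (x + y)"
    using norming_functional_finite[of s "x + y"] s xy by auto
  have "g \<bullet> x = lp_norm p x" "g \<bullet> y = lp_norm p y"
    using g(1) g(2)[of x] g(2)[of y] assms(3) by (simp_all add: inner_add_right)
  then obtain c d where cd: "x = c *\<^sub>R (x + y)" "y = d *\<^sub>R (x + y)" using g(3) by metis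
  then have "d \<noteq> 0" using assms(4) by auto
  then have "x = (c / d) *\<^sub>R y" using cd by (metis nonzero_eq_divide_eq scaleR_scaleR)
  then show ?thesis ..
qed

subsection \<open>Perturbations as vectors of a ball\<close>

lemma uncertainty_set_ball:
  fixes b :: "real ^ 'n" and w :: "real ^ 'm"
  assumes "0 \<le> l" "1 \<le> q" "1 \<le> r" "lp_norm r w \<le> l * lp_norm q b"
  obtains D :: "real ^ 'n ^ 'm" where "D \<in> uncertainty_set l q r" "D *v b = w"
proof (cases "b = 0")
  case True
  then have "w = 0"
    using assms lp_norm_pos_iff[OF assms(3), of w] by (simp add: lp_norm_zero not_less[symmetric])
  moreover have "(0 :: real ^ 'n ^ 'm) \<in> uncertainty_set l q r"
    using assms by (simp add: uncertainty_set_iff lp_norm_zero lp_norm_nonneg)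
  ultimately show ?thesis using that[of 0] by simp
next
  case False
  obtain g where g: "g \<bullet> b = lp_norm q b" "\<And>x. g \<bullet> x \<le> lp_norm q x"
    using norming_functional[OF assms(2)] by metis
  have b: "0 < lp_norm q b" using lp_norm_pos_iff[OF assms(2)] False by blast
  \<comment> \<open>The outer product of \<open>w\<close> and \<open>g\<close>, scaled to send
    \<open>b\<close> to \<open>w\<close>. It is admissible because \<open>g\<close> is bounded at
    both \<open>x\<close> and \<open>- x\<close>.\<close>
  define D :: "real ^ 'n ^ 'm" where "D = (\<chi> i j. w $ i * g $ j / lp_norm q b)"
  have D: "D *v x = ((g \<bullet> x) / lp_norm q b) *\<^sub>R w" for x
    by (simp add: D_def matrix_vector_mult_def vec_eq_iff inner_vec_def sum_divide_distrib
        sum_distrib_left mult.assoc sum_distrib_right) (simp add: ac_simps)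
  have "lp_norm r (D *v x) \<le> l * lp_norm q x" for x
  proof -
    have "\<bar>g \<bullet> x\<bar> \<le> lp_norm q x"
      using g(2)[of x] g(2)[of "- x"] lp_norm_scaleR[OF assms(2), of "-1" x] by simp
    then have "\<bar>g \<bullet> x\<bar> * lp_norm r w \<le> lp_norm q x * (l * lp_norm q b)"
      using assms(4) by (intro mult_mono) (auto simp: lp_norm_nonneg)
    then show ?thesis
      using b by (simp add: D lp_norm_scaleR assms(3) field_simps)
  qed
  then have "D \<in> uncertainty_set l q r" using assms by (simp add: uncertainty_set_iff)
  moreover have "D *v b = w" using b by (simp add: D g)
  ultimately show ?thesis using that by blast
qed

text \<open>Together with \<open>robust_max_ball_ge\<close> this replaces matrices by vectors of a
  ball; later arguments use only these two facts about perturbations.\<close>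

lemma robust_max_ball_attained:
  fixes z :: "real ^ 'm" and b :: "real ^ 'n"
  assumes "0 \<le> l" "1 \<le> p" "1 \<le> q" "1 \<le> r"
  obtains w where "lp_norm r w \<le> l * lp_norm q b" "robust_max l p q r z b = lp_norm p (z + w)"
  using robust_max_attained[OF assms, of z b] uncertainty_set_iff[OF assms(3,4)] by metis

lemma robust_max_ball_ge:
  fixes z w :: "real ^ 'm" and b :: "real ^ 'n"
  assumes "0 \<le> l" "1 \<le> p" "1 \<le> q" "1 \<le> r" "lp_norm r w \<le> l * lp_norm q b"
  shows "lp_norm p (z + w) \<le> robust_max l p q r z b"
  using robust_max_attained[OF assms(1-4), of z b]
    uncertainty_set_ball[OF assms(1,3,4,5)] by metis

text \<open>Homogeneity makes \<open>delta\<close> the least constant in this comparison;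
  \<open>delta_le\<close> is the other half.\<close>

lemma lp_norm_le_delta:
  fixes x :: "real ^ 'm"
  assumes "1 \<le> a" "1 \<le> b"
  shows "lp_norm a x \<le> delta TYPE('m) a b * lp_norm b x"
proof (cases "x = 0")
  case False
  have "lp_norm a ((1 / lp_norm b x) *\<^sub>R x) \<le> delta TYPE('m) a b"
    using delta_attained[OF assms, of "TYPE('m)"] lp_norm_normalize[OF assms(2) False] by metis
  then show ?thesis
    using False lp_norm_pos_iff[OF assms(2), of x]
    by (simp add: lp_norm_scaleR assms(1) field_simps)
qed (simp add: lp_norm_zero)

lemma delta_le:
  assumes "1 \<le> a" "1 \<le> b" "\<And>x :: real ^ 'm. lp_norm a x \<le> c * lp_norm b x"
  shows "delta TYPE('m) a b \<le> c"
  using delta_attained[OF assms(1,2), of "TYPE('m)"] assms(3) by (metis mult.right_neutral)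

lemma delta_pos:
  assumes "1 \<le> a" "1 \<le> b"
  shows "0 < delta TYPE('m::finite) a b"
proof -
  have "0 < lp_norm a (1 :: real ^ 'm)" "0 < lp_norm b (1 :: real ^ 'm)"
    using assms by (simp_all add: lp_norm_pos_iff)
  then show ?thesis
    using lp_norm_le_delta[OF assms, of "1 :: real ^ 'm"]
    by (metis less_le_trans zero_less_mult_pos2)
qed

subsection \<open>Comparison of norms\<close>

lemma lp_norm_one: "lp_norm 1 x = (\<Sum>i\<in>UNIV. \<bar>x $ i\<bar>)"
  by (simp add: lp_norm_def sum_nonneg)

lemma lp_norm_axis: "1 \<le> p \<Longrightarrow> lp_norm p (axis i 1 :: real ^ 'k) = 1"
proof (erule ereal_ge1_cases)
  assume "p = \<infinity>"
  obtain j where "infnorm (axis i 1 :: real ^ 'k) = \<bar>(axis i 1 :: real ^ 'k) $ j\<bar>"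
    using infnorm_attained_cart by blast
  then have "infnorm (axis i 1 :: real ^ 'k) \<le> 1" by (simp add: axis_def)
  then show ?thesis
    using component_le_infnorm_cart[of "axis i 1 :: real ^ 'k" i] \<open>p = \<infinity>\<close>
    by (simp add: lp_norm_def)
next
  fix s assume "p = ereal s" "1 \<le> s"
  moreover have "\<bar>(axis i 1 :: real ^ 'k) $ j\<bar> powr s = (if j = i then 1 else 0)" for j
    by (simp add: axis_def)
  ultimately show ?thesis by (simp add: lp_norm_def)
qed

text \<open>The power mean inequality, normalized so that the vector of ones is extremal. Its strict
  part is why maximizers have coordinates of constant absolute value.\<close>

lemma lp_norm_le_ones:
  fixes u :: "real ^ 'k"
  assumes "1 \<le> a" "a < b" "lp_norm b u \<le> lp_norm b (1 :: real ^ 'k)"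
  shows "lp_norm a u \<le> lp_norm a (1 :: real ^ 'k)"
    and "\<bar>u $ i\<bar> \<noteq> 1 \<Longrightarrow> lp_norm a u < lp_norm a (1 :: real ^ 'k)"
proof -
  obtain s where s: "a = ereal s" "1 \<le> s" using assms(1,2) by (cases a) auto
  have "(\<Sum>i\<in>UNIV. \<bar>u $ i\<bar> powr s) \<le> CARD('k) \<and>
    ((\<exists>i. \<bar>u $ i\<bar> \<noteq> 1) \<longrightarrow> (\<Sum>i\<in>UNIV. \<bar>u $ i\<bar> powr s) < CARD('k))"
  proof -
    obtain f :: "'k \<Rightarrow> real" where f: "\<And>i. \<bar>u $ i\<bar> powr s \<le> f i"
      "\<And>i. \<bar>u $ i\<bar> \<noteq> 1 \<Longrightarrow> \<bar>u $ i\<bar> powr s < f i" "sum f UNIV \<le> CARD('k)"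
    proof (cases b)
      case PInf
      have "infnorm (1 :: real ^ 'k) = 1" using infnorm_attained_cart[of "1 :: real ^ 'k"] by simp
      then have u: "\<bar>u $ i\<bar> \<le> 1" for i
        using assms(3) PInf component_le_infnorm_cart[of u i] by (simp add: lp_norm_def)
      show ?thesis
      proof (rule that[of "\<lambda>_. 1"])
        show "\<bar>u $ i\<bar> powr s \<le> 1" for i using u[of i] s by (simp add: powr_le1)
        show "\<bar>u $ i\<bar> powr s < 1" if "\<bar>u $ i\<bar> \<noteq> 1" for i
          using u[of i] s that powr_less_mono2[of s "\<bar>u $ i\<bar>" 1] by simp
      qed simp
    next
      case (real t)
      then have t: "s < t" "1 \<le> t" using assms(2) s by auto
      have "(\<Sum>i\<in>UNIV. \<bar>u $ i\<bar> powr t) \<le> CARD('k)"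
        using assms(3) real t lp_norm_powr[of t "1 :: real ^ 'k"] lp_norm_nonneg[of "ereal t" "1 :: real ^ 'k"]
        by (simp add: lp_norm_le_iff)
      \<comment> \<open>The constraint on \<open>u\<close> makes the linear terms of the tangents
        sum to at most 0.\<close>
      then have "(s / t) * (\<Sum>i\<in>UNIV. \<bar>u $ i\<bar> powr t - 1) \<le> 0"
        using s t by (intro mult_nonneg_nonpos) (auto simp: sum_subtractf)
      then have "(\<Sum>i\<in>(UNIV :: 'k set). 1 + s / t * (\<bar>u $ i\<bar> powr t - 1)) \<le> CARD('k)"
        by (simp add: sum.distrib sum_distrib_left)
      moreover have eq: "\<bar>u $ i\<bar> powr s = (\<bar>u $ i\<bar> powr t) powr (s / t)" for i
        using t by (simp add: powr_powr)
      have "\<bar>u $ i\<bar> powr s \<le> 1 + s / t * (\<bar>u $ i\<bar> powr t - 1)" for i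
        unfolding eq using s t by (intro powr_le_tangent) auto
      moreover have "\<bar>u $ i\<bar> powr s < 1 + s / t * (\<bar>u $ i\<bar> powr t - 1)" if "\<bar>u $ i\<bar> \<noteq> 1" for i
      proof -
        have "(\<bar>u $ i\<bar> powr t) powr (1 / t) = \<bar>u $ i\<bar>" using t by (simp add: powr_powr)
        then have "\<bar>u $ i\<bar> powr t \<noteq> 1" using that by force
        then show ?thesis unfolding eq using s t by (intro powr_le_tangent) auto
      qed
      ultimately show ?thesis
        using that[of "\<lambda>i. 1 + s / t * (\<bar>u $ i\<bar> powr t - 1)"] by simp
    qed (use assms in auto)
    have "(\<Sum>i\<in>UNIV. \<bar>u $ i\<bar> powr s) \<le> sum f UNIV" by (intro sum_mono f)
    moreover have "(\<Sum>i\<in>UNIV. \<bar>u $ i\<bar> powr s) < sum f UNIV" if "\<exists>i. \<bar>u $ i\<bar> \<noteq> 1"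
      using f that by (intro sum_strict_mono_ex1) auto
    ultimately show ?thesis using f(3) by (meson order_trans less_le_trans)
  qed
  then show "lp_norm a u \<le> lp_norm a (1 :: real ^ 'k)"
    "\<bar>u $ i\<bar> \<noteq> 1 \<Longrightarrow> lp_norm a u < lp_norm a (1 :: real ^ 'k)"
    using s lp_norm_powr[OF s(2), of "1 :: real ^ 'k"]
    by (auto simp: lp_norm_le_iff lp_norm_less_iff lp_norm_nonneg)
qed

lemma lp_norm_ones_mult:
  fixes u :: "real ^ 'k"
  assumes "1 \<le> a" "a \<le> b"
  shows "lp_norm a u * lp_norm b (1 :: real ^ 'k) \<le> lp_norm a (1 :: real ^ 'k) * lp_norm b u"
proof (cases "u = 0 \<or> a = b")
  case False
  have b: "1 \<le> b" using assms by simp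
  have pos: "0 < lp_norm b u" "0 < lp_norm b (1 :: real ^ 'k)"
    using False b by (simp_all add: lp_norm_pos_iff)
  define k where "k = lp_norm b (1 :: real ^ 'k) / lp_norm b u"
  have "lp_norm a (k *\<^sub>R u) \<le> lp_norm a (1 :: real ^ 'k)"
  proof (rule lp_norm_le_ones(1)[OF assms(1)])
    show "a < b" using False assms(2) by auto
    show "lp_norm b (k *\<^sub>R u) \<le> lp_norm b (1 :: real ^ 'k)"
      using pos by (simp add: lp_norm_scaleR b k_def)
  qed
  then show ?thesis
    using pos by (simp add: lp_norm_scaleR assms k_def field_simps)
qed (auto simp: lp_norm_zero)

text \<open>Coordinates of a unit vector are at most 1 in absolute value, so their powers do not
  grow with the exponent. A second nonzero coordinate keeps the first strictly below 1, where the
  power strictly drops.\<close>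

lemma lp_norm_unit_antimono:
  fixes u :: "real ^ 'k"
  assumes "1 \<le> a" "a < b" "lp_norm a u = 1"
  shows "lp_norm b u \<le> 1"
    and "b < \<infinity> \<Longrightarrow> i \<noteq> j \<Longrightarrow> u $ i \<noteq> 0 \<Longrightarrow> u $ j \<noteq> 0 \<Longrightarrow> lp_norm b u < 1"
proof -
  obtain s where s: "a = ereal s" "1 \<le> s" using assms(1,2) by (cases a) auto
  have le1: "\<bar>u $ i\<bar> \<le> 1" for i using component_le_lp_norm[OF assms(1), of u i] assms(3) by simp
  have sum1: "(\<Sum>i\<in>UNIV. \<bar>u $ i\<bar> powr s) = 1" using lp_norm_powr[OF s(2), of u] s assms(3) by simp
  have mono: "\<bar>u $ i\<bar> powr t \<le> \<bar>u $ i\<bar> powr s" if "s < t" for i t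
    using le1[of i] that by (intro powr_mono') auto
  show "lp_norm b u \<le> 1"
  proof (cases b)
    case PInf
    then show ?thesis using infnorm_attained_cart[of u] le1 by (auto simp: lp_norm_def)
  next
    case (real t)
    then have "s < t" using assms(2) s by simp
    then have "(\<Sum>i\<in>UNIV. \<bar>u $ i\<bar> powr t) \<le> 1"
      unfolding sum1[symmetric] by (intro sum_mono mono)
    then show ?thesis using real \<open>s < t\<close> s by (simp add: lp_norm_le_iff)
  qed (use assms in auto)
  show "lp_norm b u < 1" if "b < \<infinity>" "i \<noteq> j" "u $ i \<noteq> 0" "u $ j \<noteq> 0"
  proof -
    obtain t where t: "b = ereal t" "s < t" using assms(2) s \<open>b < \<infinity>\<close> by (cases b) auto
    have "\<bar>u $ i\<bar> powr s + \<bar>u $ j\<bar> powr s = (\<Sum>k\<in>{i, j}. \<bar>u $ k\<bar> powr s)"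
      using that by simp
    also have "\<dots> \<le> 1" unfolding sum1[symmetric] by (rule sum_mono2) auto
    finally have "\<bar>u $ i\<bar> powr s < 1" using that by (smt (verit) powr_gt_zero abs_le_zero_iff)
    then have "\<bar>u $ i\<bar> \<noteq> 1" by auto
    then have "\<bar>u $ i\<bar> powr t < \<bar>u $ i\<bar> powr s"
      using le1[of i] that t by (intro powr_less_mono') auto
    then have "(\<Sum>i\<in>UNIV. \<bar>u $ i\<bar> powr t) < (\<Sum>i\<in>UNIV. \<bar>u $ i\<bar> powr s)"
      using mono[OF t(2)] by (intro sum_strict_mono_ex1) auto
    then show ?thesis using sum1 t s by (simp add: lp_norm_less_iff)
  qed
qed

lemma lp_norm_antimono:
  fixes u :: "real ^ 'k"
  assumes "1 \<le> a" "a < b"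
  shows "lp_norm b u \<le> lp_norm a u"
    and "b < \<infinity> \<Longrightarrow> i \<noteq> j \<Longrightarrow> u $ i \<noteq> 0 \<Longrightarrow> u $ j \<noteq> 0 \<Longrightarrow> lp_norm b u < lp_norm a u"
proof -
  have b: "1 \<le> b" using assms by simp
  define v where "v = (1 / lp_norm a u) *\<^sub>R u"
  show "lp_norm b u \<le> lp_norm a u"
  proof (cases "u = 0")
    case False
    then have "lp_norm b v \<le> 1"
      unfolding v_def
      by (intro lp_norm_unit_antimono(1)[OF assms] lp_norm_normalize[OF assms(1)])
    then show ?thesis
      using False lp_norm_pos_iff[OF assms(1), of u] by (simp add: v_def lp_norm_scaleR b)
  qed (simp add: lp_norm_zero)
  show "lp_norm b u < lp_norm a u" if "b < \<infinity>" "i \<noteq> j" "u $ i \<noteq> 0" "u $ j \<noteq> 0"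
  proof -
    have u: "u \<noteq> 0" using that by auto
    then have pos: "0 < lp_norm a u" using lp_norm_pos_iff[OF assms(1)] by blast
    have "lp_norm a v = 1" unfolding v_def by (rule lp_norm_normalize[OF assms(1) u])
    then have "lp_norm b v < 1"
      using that pos by (intro lp_norm_unit_antimono(2)[OF assms, of _ i j]) (auto simp: v_def)
    then show ?thesis using pos by (simp add: v_def lp_norm_scaleR b)
  qed
qed

text \<open>For \<open>r < p\<close> a unit vector shows that \<open>delta\<close> is at least 1, so
  \<open>u\<close> loses no norm from \<open>r\<close> to \<open>p\<close> and cannot have two
  nonzero coordinates. For \<open>p < r\<close> and nonzero \<open>u\<close>, the multiple with the
  \<open>r\<close>-norm of the ones vector must have all coordinates of absolute value 1.\<close>

lemma delta_maximizer_degenerate: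
  fixes u :: "real ^ 'm"
  assumes "1 \<le> p" "p < \<infinity>" "1 \<le> r" "p \<noteq> r" "i \<noteq> j"
    and max: "lp_norm p u = delta TYPE('m) p r * lp_norm r u"
  shows "u $ i = 0 \<or> u $ j = 0 \<or> \<bar>u $ i\<bar> = \<bar>u $ j\<bar>"
proof (cases "r < p")
  case True
  have "1 \<le> delta TYPE('m) p r"
    using lp_norm_le_delta[OF assms(1,3), of "axis i 1 :: real ^ 'm"]
    by (simp add: lp_norm_axis assms)
  then have "lp_norm r u \<le> lp_norm p u"
    unfolding max using mult_right_mono[of 1 _ "lp_norm r u"] by (simp add: lp_norm_nonneg)
  then show ?thesis
    using lp_norm_antimono(2)[OF assms(3) True assms(2,5), of u] by linarith
next
  case False
  then have pr: "p < r" using assms(4) by simp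
  show ?thesis
  proof (rule ccontr)
    assume neg: "\<not> ?thesis"
    then have "u \<noteq> 0" by auto
    then have pos: "0 < lp_norm r u" "0 < lp_norm r (1 :: real ^ 'm)"
      using assms(3) by (simp_all add: lp_norm_pos_iff)
    define k where "k = lp_norm r (1 :: real ^ 'm) / lp_norm r u"
    have k: "0 < k" unfolding k_def using pos by simp
    have kr: "lp_norm r (k *\<^sub>R u) = lp_norm r (1 :: real ^ 'm)"
      using pos by (simp add: lp_norm_scaleR assms(3) k_def)
    have "\<bar>(k *\<^sub>R u) $ i\<bar> \<noteq> \<bar>(k *\<^sub>R u) $ j\<bar>" using neg k by (simp add: abs_mult)
    then obtain h where "\<bar>(k *\<^sub>R u) $ h\<bar> \<noteq> 1" by metis
    then have "lp_norm p (k *\<^sub>R u) < lp_norm p (1 :: real ^ 'm)"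
      using lp_norm_le_ones(2)[OF assms(1) pr, of "k *\<^sub>R u"] kr by simp
    also have "\<dots> \<le> delta TYPE('m) p r * lp_norm r (k *\<^sub>R u)"
      unfolding kr by (rule lp_norm_le_delta[OF assms(1,3)])
    also have "\<dots> = lp_norm p (k *\<^sub>R u)"
      by (simp add: lp_norm_scaleR assms(1,3) max)
    finally show False by simp
  qed
qed

subsection \<open>Vectors with small gap\<close>

text \<open>The tangent at \<open>x\<close> supports the convex power: Young's inequality for
  \<open>x\<close> and \<open>x + h\<close>. It lets a small increase of the base absorb additive
  errors.\<close>

lemma powr_add_ge:
  fixes x h s :: real
  assumes "1 \<le> s" "0 < x" "0 \<le> h"
  shows "x powr s + s * x powr (s - 1) * h \<le> (x + h) powr s"
proof -
  have "x powr (s - 1) * (x + h) \<le> (x + h) powr s / s + (1 - 1 / s) * x powr s"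
    using young_signed(1)[OF assms(1), of x "x + h"] assms by simp
  then have "s * (x powr (s - 1) * (x + h)) \<le> s * ((x + h) powr s / s + (1 - 1 / s) * x powr s)"
    using assms by (intro mult_left_mono) auto
  moreover have "x powr (s - 1) * x = x powr s" using assms by (simp add: powr_diff)
  ultimately show ?thesis using assms by (simp add: algebra_simps)
qed

text \<open>The witness is a large multiple of a unit vector: the other coordinates of the perturbation enter
  the sum of powers only through a constant.\<close>

lemma gap_axis:
  fixes \<rho> e s :: real
  assumes "1 < s" "1 \<le> r" "0 \<le> \<rho>" "0 < e"
  obtains z :: "real ^ 'm" where
    "\<And>w. lp_norm r w \<le> \<rho> \<Longrightarrow> lp_norm (ereal s) (z + w) \<le> lp_norm (ereal s) z + \<rho> + e"
proof -
  \<comment> \<open>\<open>K\<close> bounds the powers of all perturbed coordinates.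
    \<open>T\<close> is so large that raising the base from \<open>T\<close> to \<open>T + e\<close>
    adds at least \<open>K\<close>; here \<open>1 < s\<close> matters. The \<open>+ 1\<close> keeps
    \<open>T - \<rho>\<close> positive.\<close>
  define K where "K = CARD('m) * \<rho> powr s"
  define T where "T = (K / (s * e)) powr (1 / (s - 1)) + \<rho> + 1"
  have K: "0 \<le> K" by (simp add: K_def)
  have T: "0 < T" "\<rho> \<le> T" using assms by (auto simp: T_def intro: add_nonneg_pos add_nonneg_nonneg)
  have "K / (s * e) = ((K / (s * e)) powr (1 / (s - 1))) powr (s - 1)"
    using assms K by (simp add: powr_powr)
  also have "\<dots> \<le> T powr (s - 1)"
    unfolding T_def using assms by (intro powr_mono2) auto
  finally have KT: "K \<le> s * T powr (s - 1) * e" using assms by (simp add: field_simps)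
  fix i :: 'm
  \<comment> \<open>The length \<open>T - \<rho>\<close> leaves room for the perturbation:
    coordinate \<open>i\<close> of \<open>z + w\<close> stays at most \<open>T\<close> in absolute
    value.\<close>
  define z :: "real ^ 'm" where "z = (T - \<rho>) *\<^sub>R axis i 1"
  have z: "lp_norm (ereal s) z = T - \<rho>"
    using T assms by (simp add: z_def lp_norm_scaleR lp_norm_axis)
  show ?thesis
  proof (rule that[of z])
    fix w :: "real ^ 'm" assume "lp_norm r w \<le> \<rho>"
    then have w: "\<bar>w $ j\<bar> \<le> \<rho>" for j using component_le_lp_norm[OF assms(2), of w j] by simp
    have "\<bar>(z + w) $ j\<bar> powr s \<le> (if j = i then T powr s else 0) + \<rho> powr s" for j
    proof (cases "j = i")
      case True
      have "\<bar>(z + w) $ i\<bar> \<le> T" using w[of i] T by (simp add: z_def)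
      then have "\<bar>(z + w) $ i\<bar> powr s \<le> T powr s" using assms by (intro powr_mono2) auto
      then show ?thesis using True by (simp add: add_increasing2)
    next
      case False
      then show ?thesis using w[of j] assms by (auto simp: z_def axis_def intro!: powr_mono2)
    qed
    then have "(\<Sum>j\<in>UNIV. \<bar>(z + w) $ j\<bar> powr s) \<le>
        (\<Sum>j\<in>UNIV. (if j = i then T powr s else 0) + \<rho> powr s)"
      by (intro sum_mono)
    also have "\<dots> = T powr s + K" by (simp add: sum.distrib K_def)
    also have "\<dots> \<le> T powr s + s * T powr (s - 1) * e" using KT by simp
    also have "\<dots> \<le> (T + e) powr s" using assms T by (intro powr_add_ge) auto
    finally have "lp_norm (ereal s) (z + w) \<le> T + e"
      using assms T by (simp add: lp_norm_le_iff)
    then show "lp_norm (ereal s) (z + w) \<le> lp_norm (ereal s) z + \<rho> + e" using z by simp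
  qed
qed

text \<open>The difference quotient of the power at 1 tends to \<open>s\<close>, so every larger
  slope is an upper bound near 1.\<close>

lemma one_plus_powr_le:
  fixes s e :: real
  assumes "0 < e"
  obtains d where "0 < d" "\<And>y. 0 \<le> y \<Longrightarrow> y < d \<Longrightarrow> (1 + y) powr s \<le> 1 + (s + e) * y"
proof -
  have "((\<lambda>x. x powr s) has_real_derivative s * 1 powr (s - 1)) (at 1)"
    by (rule has_real_derivative_powr) simp
  then have "(\<lambda>h. ((1 + h) powr s - 1) / h) \<midarrow>0\<rightarrow> s"
    by (simp add: DERIV_def)
  from LIM_D[OF this assms] obtain d where d: "0 < d"
    "\<And>h. h \<noteq> 0 \<Longrightarrow> \<bar>h\<bar> < d \<Longrightarrow> \<bar>((1 + h) powr s - 1) / h - s\<bar> < e"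
    unfolding diff_zero real_norm_def by blast
  show ?thesis
  proof (rule that[OF d(1)])
    fix y :: real assume y: "0 \<le> y" "y < d"
    show "(1 + y) powr s \<le> 1 + (s + e) * y"
    proof (cases "y = 0")
      case False
      then have "((1 + y) powr s - 1) / y < s + e" using d(2)[of y] y by simp
      then show ?thesis using False y by (simp add: field_simps)
    qed simp
  qed
qed

text \<open>The witness is a large multiple of the vector with all coordinates 1, where
  the gradient of the \<open>s\<close>-norm is constant and the power mean inequality bounds its \<open>r\<close>-dual norm.\<close>

lemma gap_ones:
  fixes \<rho> e s :: real
  assumes "1 < s" "1 \<le> r" "0 \<le> \<rho>" "0 < e"
  obtains z :: "real ^ 'm" where
    "\<And>w. lp_norm r w \<le> \<rho> \<Longrightarrow> lp_norm (ereal s) (z + w) \<le> lp_norm (ereal s) z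
      + \<rho> * (lp_norm (ereal s) (1 :: real ^ 'm) / lp_norm r (1 :: real ^ 'm)) + e"
proof -
  define N where "N = lp_norm (ereal s) (1 :: real ^ 'm)"
  define R where "R = lp_norm r (1 :: real ^ 'm)"
  have NR: "0 < N" "0 < R" using assms by (simp_all add: N_def R_def lp_norm_pos_iff)
  have Ns: "N powr s = CARD('m)" unfolding N_def using assms by (subst lp_norm_powr) auto
  \<comment> \<open>The excess slope allowed in the linearization: its total effect
    \<open>\<eta> * \<rho> / R\<close> is at most \<open>s * e / N\<close>. The \<open>+ 1\<close>
    covers \<open>\<rho> = 0\<close>.\<close>
  define \<eta> where "\<eta> = s * e * R / (N * (\<rho> + 1))"
  have \<eta>: "0 < \<eta>" unfolding \<eta>_def using assms NR by simp
  have \<eta>_le: "\<eta> * \<rho> / R \<le> s * e / N"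
  proof -
    have "\<eta> * \<rho> / R = s * e / N * (\<rho> / (\<rho> + 1))"
      unfolding \<eta>_def using NR by simp
    also have "\<dots> \<le> s * e / N" using assms NR by (intro mult_left_le) auto
    finally show ?thesis .
  qed
  obtain d where d: "0 < d" "\<And>y. 0 \<le> y \<Longrightarrow> y < d \<Longrightarrow> (1 + y) powr s \<le> 1 + (s + \<eta>) * y"
    using one_plus_powr_le[OF \<eta>] by metis
  \<comment> \<open>The scale makes every relative perturbation \<open>\<bar>w $ i\<bar> / t\<close>
    smaller than \<open>d\<close>.\<close>
  define t where "t = (\<rho> + 1) / d"
  have t: "0 < t" "\<rho> / t < d" using assms d by (simp_all add: t_def field_simps)
  show ?thesis
  proof (rule that[of "t *\<^sub>R 1"])
    fix w :: "real ^ 'm" assume w: "lp_norm r w \<le> \<rho>"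
    \<comment> \<open>To first order only the 1-norm of \<open>w\<close> matters; power means
      compare it with the \<open>r\<close>-norm.\<close>
    have "(\<Sum>i\<in>UNIV. \<bar>w $ i\<bar>) * R \<le> CARD('m) * lp_norm r w"
      using lp_norm_ones_mult[of 1 r w] assms(2) by (simp add: lp_norm_one R_def)
    also have "\<dots> \<le> CARD('m) * \<rho>" using w by (intro mult_left_mono) auto
    finally have sumw: "(\<Sum>i\<in>UNIV. \<bar>w $ i\<bar>) \<le> CARD('m) * \<rho> / R"
      using NR by (simp add: field_simps)
    \<comment> \<open>The target relative increase: \<open>t * N * (1 + y)\<close> is exactly
      \<open>t * N + \<rho> * (N / R) + e\<close>.\<close>
    define y where "y = \<rho> / (R * t) + e / (N * t)"
    have y: "0 \<le> y" using assms NR t by (simp add: y_def)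
    have coord: "\<bar>t + w $ i\<bar> powr s \<le> t powr s * (1 + (s + \<eta>) * (\<bar>w $ i\<bar> / t))" for i
    proof -
      have "\<bar>w $ i\<bar> \<le> \<rho>" using component_le_lp_norm[OF assms(2), of w i] w by simp
      then have "\<bar>w $ i\<bar> / t \<le> \<rho> / t" using t by (simp add: divide_right_mono)
      then have "(1 + \<bar>w $ i\<bar> / t) powr s \<le> 1 + (s + \<eta>) * (\<bar>w $ i\<bar> / t)"
        using t by (intro d) auto
      moreover have "\<bar>t + w $ i\<bar> powr s \<le> (t * (1 + \<bar>w $ i\<bar> / t)) powr s"
        using t assms by (intro powr_mono2) (auto simp: distrib_left)
      moreover have "(t * (1 + \<bar>w $ i\<bar> / t)) powr s = t powr s * (1 + \<bar>w $ i\<bar> / t) powr s"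
        by (rule powr_mult)
      ultimately show ?thesis by (smt (verit) mult_left_mono powr_ge_zero)
    qed
    have "(\<Sum>i\<in>UNIV. \<bar>(t *\<^sub>R 1 + w) $ i\<bar> powr s) \<le>
        (\<Sum>i\<in>UNIV. t powr s * (1 + (s + \<eta>) * (\<bar>w $ i\<bar> / t)))"
      using coord by (intro sum_mono) simp
    also have "\<dots> = t powr s * (CARD('m) + (s + \<eta>) * ((\<Sum>i\<in>UNIV. \<bar>w $ i\<bar>) / t))"
      by (simp add: sum_distrib_left sum.distrib sum_divide_distrib distrib_left)
    also have "\<dots> \<le> t powr s * (CARD('m) + (s + \<eta>) * ((CARD('m) * \<rho> / R) / t))"
      using sumw t assms \<eta> by (intro mult_left_mono add_left_mono divide_right_mono) auto
    also have "\<dots> = t powr s * CARD('m) * (1 + (s * \<rho> / R + \<eta> * \<rho> / R) / t)"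
      by (simp add: algebra_simps add_divide_distrib)
    also have "\<dots> \<le> t powr s * CARD('m) * (1 + (s * \<rho> / R + s * e / N) / t)"
      using \<eta>_le t by (intro mult_left_mono add_left_mono divide_right_mono) auto
    also have "\<dots> = t powr s * CARD('m) * (1 + s * y)"
      using t NR by (simp add: y_def field_simps)
    also have "\<dots> \<le> t powr s * CARD('m) * (1 + y) powr s"
      using powr_add_ge[of s 1 y] y assms by (intro mult_left_mono) auto
    also have "\<dots> = (t * N * (1 + y)) powr s"
      using t NR y by (simp add: powr_mult Ns)
    finally have "lp_norm (ereal s) (t *\<^sub>R 1 + w) \<le> t * N * (1 + y)"
      using assms t NR y by (simp add: lp_norm_le_iff)
    also have "\<dots> = t * N + \<rho> * (N / R) + e"
      using t NR by (simp add: y_def field_simps)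
    finally show "lp_norm (ereal s) (t *\<^sub>R 1 + w) \<le> lp_norm (ereal s) (t *\<^sub>R (1 :: real ^ 'm))
        + \<rho> * (lp_norm (ereal s) (1 :: real ^ 'm) / lp_norm r (1 :: real ^ 'm)) + e"
      using assms t by (simp add: lp_norm_scaleR flip: N_def R_def)
  qed
qed

subsection \<open>The robust maximum\<close>

lemma robust_max_upper:
  fixes z :: "real ^ 'm" and b :: "real ^ 'n"
  assumes "0 \<le> l" "1 \<le> p" "1 \<le> q" "1 \<le> r"
  shows "robust_max l p q r z b \<le> lp_norm p z + l * delta TYPE('m) p r * lp_norm q b"
proof -
  obtain w where w: "lp_norm r w \<le> l * lp_norm q b" "robust_max l p q r z b = lp_norm p (z + w)"
    using robust_max_ball_attained[OF assms] by metis
  have "lp_norm p w \<le> delta TYPE('m) p r * lp_norm r w" by (rule lp_norm_le_delta[OF assms(2,4)])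
  also have "\<dots> \<le> delta TYPE('m) p r * (l * lp_norm q b)"
    using w(1) delta_pos[OF assms(2,4), where 'm = 'm] by (intro mult_left_mono) auto
  finally show ?thesis using w(2) lp_norm_triangle[OF assms(2), of z w] by (simp add: ac_simps)
qed

text \<open>The perturbation spends the whole radius along \<open>v\<close>, and norms of
  nonnegative multiples of one vector add. The form \<open>c *\<^sub>R v\<close> leaves the
  direction free when the base point is zero.\<close>

lemma robust_max_lower_parallel:
  fixes v :: "real ^ 'm" and b :: "real ^ 'n"
  assumes "0 \<le> l" "1 \<le> p" "1 \<le> q" "1 \<le> r" "v \<noteq> 0" "0 \<le> c"
  shows "lp_norm p (c *\<^sub>R v) + l * lp_norm q b * (lp_norm p v / lp_norm r v)
    \<le> robust_max l p q r (c *\<^sub>R v) b"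
proof -
  define k where "k = l * lp_norm q b / lp_norm r v"
  have v: "0 < lp_norm r v" using lp_norm_pos_iff[OF assms(4)] assms(5) by blast
  have k: "0 \<le> k" using assms by (simp add: k_def lp_norm_nonneg)
  have "lp_norm r (k *\<^sub>R v) = l * lp_norm q b"
    using v k by (simp add: lp_norm_scaleR assms(4)) (simp add: k_def)
  then have "lp_norm p (c *\<^sub>R v + k *\<^sub>R v) \<le> robust_max l p q r (c *\<^sub>R v) b"
    using assms by (intro robust_max_ball_ge) auto
  moreover have "lp_norm p (c *\<^sub>R v + k *\<^sub>R v) = lp_norm p (c *\<^sub>R v) + k * lp_norm p v"
    using k assms(6) by (simp add: lp_norm_scaleR assms(2) distrib_right flip: scaleR_left_distrib)
  ultimately show ?thesis by (simp add: k_def)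
qed

lemma robust_max_lower:
  fixes z :: "real ^ 'm" and b :: "real ^ 'n"
  assumes "0 \<le> l" "1 \<le> p" "1 \<le> q" "1 \<le> r"
  shows "lp_norm p z + l / delta TYPE('m) r p * lp_norm q b \<le> robust_max l p q r z b"
proof -
  obtain v :: "real ^ 'm" and c :: real where v: "v \<noteq> 0" "0 \<le> c" "z = c *\<^sub>R v"
  proof (cases "z = 0")
    case True
    then show ?thesis using that[of 1 0] by simp
  next
    case False
    then show ?thesis using that[of z 1] by simp
  qed
  have d: "0 < delta TYPE('m) r p" using assms by (intro delta_pos)
  have pos: "0 < lp_norm r v" using lp_norm_pos_iff[OF assms(4)] v(1) by blast
  have "1 / delta TYPE('m) r p \<le> lp_norm p v / lp_norm r v"
    using lp_norm_le_delta[OF assms(4,2), of v] d pos by (simp add: field_simps)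
  then have "l * lp_norm q b * (1 / delta TYPE('m) r p) \<le> l * lp_norm q b * (lp_norm p v / lp_norm r v)"
    using assms by (intro mult_left_mono) (auto simp: lp_norm_nonneg)
  then show ?thesis
    using robust_max_lower_parallel[OF assms v(1,2), of b] by (simp add: v(3))
qed

lemma robust_max_eq_upper:
  fixes z :: "real ^ 'm" and b :: "real ^ 'n"
  assumes "0 \<le> l" "1 \<le> p" "1 \<le> q" "1 \<le> r" "p \<in> {1, r, \<infinity>}"
  shows "robust_max l p q r z b = lp_norm p z + l * delta TYPE('m) p r * lp_norm q b"
proof (rule antisym[OF robust_max_upper[OF assms(1-4)]])
  let ?rho = "l * lp_norm q b"
  have rho: "0 \<le> ?rho" using assms by (simp add: lp_norm_nonneg)
  consider "p = r" | "p = 1" | "p = \<infinity>" using assms(5) by blast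
  then show "lp_norm p z + l * delta TYPE('m) p r * lp_norm q b \<le> robust_max l p q r z b"
  proof cases
    case 1
    \<comment> \<open>For \<open>p = r\<close> the lower bound already reaches the upper one, since
      \<open>?d \<le> 1 \<le> 1 / ?d\<close>.\<close>
    let ?d = "delta TYPE('m) r r"
    have d: "?d \<le> 1" using assms by (intro delta_le) auto
    moreover have "0 < ?d" using assms by (intro delta_pos)
    ultimately have "?d \<le> 1 / ?d" by (meson le_divide_eq_1_pos order_trans)
    then have "?rho * ?d \<le> ?rho * (1 / ?d)" using rho by (rule mult_left_mono)
    then show ?thesis using robust_max_lower[OF assms(1-4), of z b] 1 by (simp add: ac_simps)
  next
    case 2
    obtain u :: "real ^ 'm" where u: "lp_norm r u = 1" "delta TYPE('m) p r = lp_norm p u"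
      using delta_attained[OF assms(2,4), of "TYPE('m)"] by blast
    \<comment> \<open>Giving the maximizer \<open>u\<close> the signs of \<open>z\<close> keeps its
      norms and makes the absolute values of coordinates add.\<close>
    define w :: "real ^ 'm" where "w = (\<chi> i. if z $ i \<ge> 0 then \<bar>u $ i\<bar> else - \<bar>u $ i\<bar>)"
    have w_abs: "\<bar>w $ i\<bar> = \<bar>u $ i\<bar>" for i by (simp add: w_def)
    have "lp_norm r w = lp_norm r u" by (simp add: lp_norm_def infnorm_cart w_abs)
    then have "lp_norm p (z + ?rho *\<^sub>R w) \<le> robust_max l p q r z b"
      using u rho assms by (intro robust_max_ball_ge) (auto simp: lp_norm_scaleR)
    moreover have "\<bar>(z + ?rho *\<^sub>R w) $ i\<bar> = \<bar>z $ i\<bar> + ?rho * \<bar>u $ i\<bar>" for i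
    proof -
      have "0 \<le> ?rho * \<bar>u $ i\<bar>" using rho by simp
      then show ?thesis by (simp add: w_def)
    qed
    then have "lp_norm p (z + ?rho *\<^sub>R w) = lp_norm p z + ?rho * lp_norm p u"
      unfolding 2 lp_norm_one by (simp only: sum.distrib sum_distrib_left)
    ultimately show ?thesis using u(2) by (simp add: ac_simps)
  next
    case 3
    have p_norm: "lp_norm p x = infnorm x" for x :: "real ^ 'm" using 3 by (simp add: lp_norm_def)
    obtain i where i: "infnorm z = \<bar>z $ i\<bar>" using infnorm_attained_cart by blast
    \<comment> \<open>The whole radius goes into a largest coordinate of \<open>z\<close>, with its
      sign. The gain \<open>?rho\<close> suffices because \<open>delta\<close> is at most 1
      here.\<close>
    define c where "c = (if z $ i \<ge> 0 then ?rho else - ?rho)"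
    have "lp_norm p (z + c *\<^sub>R axis i 1) \<le> robust_max l p q r z b"
      using rho assms by (intro robust_max_ball_ge) (auto simp: lp_norm_scaleR lp_norm_axis c_def)
    moreover have "\<bar>(z + c *\<^sub>R axis i 1) $ i\<bar> = \<bar>z $ i\<bar> + ?rho"
      using rho by (simp add: c_def)
    then have "lp_norm p z + ?rho \<le> lp_norm p (z + c *\<^sub>R axis i 1)"
      using component_le_lp_norm[OF assms(2), of "z + c *\<^sub>R axis i 1" i] by (simp add: i p_norm)
    moreover have "delta TYPE('m) p r \<le> 1"
    proof (intro delta_le assms)
      fix x :: "real ^ 'm"
      obtain j where "infnorm x = \<bar>x $ j\<bar>" using infnorm_attained_cart by blast
      then show "lp_norm p x \<le> 1 * lp_norm r x"
        using component_le_lp_norm[OF assms(4), of x j] by (simp add: p_norm)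
    qed
    then have "?rho * delta TYPE('m) p r \<le> ?rho" using rho by (rule mult_left_le)
    ultimately show ?thesis by (simp add: ac_simps)
  qed
qed

text \<open>Equality makes both links of the upper bound tight at a maximizing \<open>w\<close>: the
  norm comparison makes \<open>w\<close> extremal for \<open>delta\<close>, the triangle inequality
  makes \<open>z\<close> a multiple of \<open>w\<close>.\<close>

lemma robust_max_eq_upperD:
  fixes z :: "real ^ 'm" and b :: "real ^ 'n"
  assumes "0 < l" "1 < p" "p < \<infinity>" "1 \<le> q" "1 \<le> r" "b \<noteq> 0"
    and eq: "robust_max l p q r z b = lp_norm p z + l * delta TYPE('m) p r * lp_norm q b"
  obtains c and u :: "real ^ 'm"
  where "z = c *\<^sub>R u" "lp_norm p u = delta TYPE('m) p r * lp_norm r u"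
proof -
  let ?d = "delta TYPE('m) p r" and ?rho = "l * lp_norm q b"
  have p: "1 \<le> p" using assms by simp
  obtain w where w: "lp_norm r w \<le> ?rho" "robust_max l p q r z b = lp_norm p (z + w)"
    using robust_max_ball_attained[OF _ p assms(4,5), of l b z] assms(1) by auto
  have d: "0 < ?d" using p assms(5) by (rule delta_pos)
  have rho: "0 < ?rho" using assms lp_norm_pos_iff[OF assms(4), of b] by simp
  have le: "lp_norm p w \<le> ?d * lp_norm r w" "?d * lp_norm r w \<le> ?d * ?rho"
    using lp_norm_le_delta[OF p assms(5)] w(1) d by (auto intro: mult_left_mono)
  have "lp_norm p z + ?d * ?rho \<le> lp_norm p z + lp_norm p w"
    using lp_norm_triangle[OF p, of z w] eq w(2) by (simp add: ac_simps)
  then have eqs: "lp_norm p w = ?d * lp_norm r w" "lp_norm p w = ?d * ?rho" using le by linarith+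
  then have "lp_norm p (z + w) = lp_norm p z + lp_norm p w"
    using eq w(2) by (simp add: ac_simps)
  moreover have "w \<noteq> 0" using eqs(2) d rho by (auto simp: lp_norm_zero)
  ultimately obtain c where "z = c *\<^sub>R w"
    using lp_norm_triangle_eqD[OF assms(2,3)] by blast
  then show ?thesis using eqs(1) that by blast
qed

text \<open>The exceptional set lies in four negligible hyperplanes: two where a coordinate
  vanishes, two where the coordinates agree up to sign.\<close>

lemma AE_coordinates_generic:
  fixes i j :: "'m::finite"
  assumes "i \<noteq> j"
  shows "AE z :: real ^ 'm in lebesgue. z $ i \<noteq> 0 \<and> z $ j \<noteq> 0 \<and> \<bar>z $ i\<bar> \<noteq> \<bar>z $ j\<bar>"
proof -
  define H where "H a = {z :: real ^ 'm. a \<bullet> z = 0}" for a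
  have H: "H a \<in> null_sets lebesgue" if "a \<noteq> 0" for a
    unfolding H_def negligible_iff_null_sets[symmetric]
    using that by (intro negligible_hyperplane) simp
  have "(axis i 1 + axis j 1 :: real ^ 'm) $ i \<noteq> 0" "(axis i 1 - axis j 1 :: real ^ 'm) $ i \<noteq> 0"
    using assms by (simp_all add: axis_def)
  then have ne: "(axis i 1 + axis j 1 :: real ^ 'm) \<noteq> 0" "(axis i 1 - axis j 1 :: real ^ 'm) \<noteq> 0"
    by (metis zero_index)+
  have "H (axis i 1) \<union> H (axis j 1) \<union> H (axis i 1 + axis j 1) \<union> H (axis i 1 - axis j 1)
    \<in> null_sets lebesgue"
    using ne by (intro null_sets.Un H) (auto simp: axis_eq_0_iff)
  then show ?thesis
    by (rule AE_I') (auto simp: H_def inner_axis' inner_left_distrib inner_diff_left abs_if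
        split: if_splits)
qed

lemma robust_max_strict_AE:
  fixes b :: "real ^ 'n"
  assumes "0 < l" "1 < p" "p < \<infinity>" "1 \<le> q" "1 \<le> r" "p \<noteq> r" "2 \<le> CARD('m)" "b \<noteq> 0"
  shows "AE z :: real ^ 'm in lebesgue.
    robust_max l p q r z b < lp_norm p z + l * delta TYPE('m) p r * lp_norm q b"
proof -
  have p: "1 \<le> p" using assms by simp
  have "\<not> card (UNIV :: 'm set) \<le> 1" using assms(7) by simp
  then obtain i j :: 'm where ij: "i \<noteq> j" using card_le_Suc0_iff_eq[of "UNIV :: 'm set"] by auto
  show ?thesis
  proof (rule AE_mp[OF AE_coordinates_generic[OF ij]], rule AE_I2, rule impI)
    fix z :: "real ^ 'm"
    assume z: "z $ i \<noteq> 0 \<and> z $ j \<noteq> 0 \<and> \<bar>z $ i\<bar> \<noteq> \<bar>z $ j\<bar>"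
    have "robust_max l p q r z b \<noteq> lp_norm p z + l * delta TYPE('m) p r * lp_norm q b"
    proof
      assume "robust_max l p q r z b = lp_norm p z + l * delta TYPE('m) p r * lp_norm q b"
      then obtain c u where cu: "z = c *\<^sub>R u" "lp_norm p u = delta TYPE('m) p r * lp_norm r u"
        using robust_max_eq_upperD[OF assms(1-5,8)] by blast
      have "u $ i = 0 \<or> u $ j = 0 \<or> \<bar>u $ i\<bar> = \<bar>u $ j\<bar>"
        using delta_maximizer_degenerate[OF p assms(3,5,6) ij cu(2)] .
      then show False using z cu(1) by (auto simp: abs_mult)
    qed
    then show "robust_max l p q r z b < lp_norm p z + l * delta TYPE('m) p r * lp_norm q b"
      using robust_max_upper[OF _ p assms(4,5), of l z b] assms(1) by simp
  qed
qed

lemma robust_max_gap: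
  fixes b :: "real ^ 'n"
  assumes "0 \<le> l" "1 < p" "p < \<infinity>" "1 \<le> q" "1 \<le> r" "p \<noteq> r" "0 < e"
  obtains z :: "real ^ 'm"
  where "robust_max l p q r z b \<le> lp_norm p z + l / delta TYPE('m) r p * lp_norm q b + e"
proof -
  let ?rho = "l * lp_norm q b" and ?d = "delta TYPE('m) r p"
  obtain s where s: "p = ereal s" "1 < s" using assms(2,3) by (cases p) auto
  have p: "1 \<le> p" using assms by simp
  have rho: "0 \<le> ?rho" using assms by (simp add: lp_norm_nonneg)
  have d: "0 < ?d" using assms(5) p by (rule delta_pos)
  \<comment> \<open>\<open>C\<close> is the norm ratio of the extremal vector, 1 or
    \<open>R / N\<close>. The bound \<open>?d \<le> C\<close> is enough, because a larger
    \<open>C\<close> only lowers the slope \<open>1 / C\<close>.\<close>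
  obtain z :: "real ^ 'm" and C where C: "0 < C" "?d \<le> C"
    and z: "\<And>w. lp_norm r w \<le> ?rho \<Longrightarrow> lp_norm p (z + w) \<le> lp_norm p z + ?rho * (1 / C) + e"
  proof (cases "p < r")
    case True
    have "?d \<le> 1" using lp_norm_antimono(1)[OF p True] by (intro delta_le assms p) simp
    moreover obtain z :: "real ^ 'm" where
      "\<And>w. lp_norm r w \<le> ?rho \<Longrightarrow> lp_norm p (z + w) \<le> lp_norm p z + ?rho + e"
      unfolding s(1) using gap_axis[OF s(2) assms(5) rho assms(7)] by metis
    ultimately show ?thesis using that[of 1 z] by simp
  next
    case False
    then have rp: "r \<le> p" by simp
    define N where "N = lp_norm p (1 :: real ^ 'm)"
    define R where "R = lp_norm r (1 :: real ^ 'm)"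
    have NR: "0 < N" "0 < R" using assms p by (simp_all add: N_def R_def lp_norm_pos_iff)
    have "?d \<le> R / N"
      using lp_norm_ones_mult[OF assms(5) rp, where 'k = 'm] NR
      by (intro delta_le assms p) (simp add: field_simps flip: N_def R_def)
    moreover obtain z :: "real ^ 'm" where
      "\<And>w. lp_norm r w \<le> ?rho \<Longrightarrow> lp_norm p (z + w) \<le> lp_norm p z + ?rho * (N / R) + e"
      unfolding s(1) N_def R_def using gap_ones[OF s(2) assms(5) rho assms(7)] by metis
    ultimately show ?thesis using that[of "R / N" z] NR by simp
  qed
  obtain w where w: "lp_norm r w \<le> ?rho" "robust_max l p q r z b = lp_norm p (z + w)"
    using robust_max_ball_attained[OF assms(1) p assms(4,5)] by metis
  have "?rho * (1 / C) \<le> ?rho * (1 / ?d)"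
    using rho C d by (intro mult_left_mono divide_left_mono) auto
  then have "robust_max l p q r z b \<le> lp_norm p z + l / ?d * lp_norm q b + e"
    using z[OF w(1)] w(2) by simp
  then show ?thesis by (rule that)
qed

theorem proposition4:
  fixes l :: real and p q r :: ereal
  assumes "0 < l" and "1 \<le> p" and "1 \<le> q" and "1 \<le> r"
  shows
    "(\<forall>(z :: real ^ 'm) (b :: real ^ 'n).
        robust_max l p q r z b \<le> lp_norm p z + l * delta TYPE('m) p r * lp_norm q b)
   \<and> (p \<in> {1, r, \<infinity>} \<longrightarrow>
        (\<forall>(z :: real ^ 'm) (b :: real ^ 'n).
          robust_max l p q r z b = lp_norm p z + l * delta TYPE('m) p r * lp_norm q b))
   \<and> (1 < p \<and> p < \<infinity> \<and> p \<noteq> r \<and> 2 \<le> CARD('m) \<longrightarrow>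
        (\<forall>b :: real ^ 'n. b \<noteq> 0 \<longrightarrow>
          (AE z :: real ^ 'm in lebesgue.
             robust_max l p q r z b < lp_norm p z + l * delta TYPE('m) p r * lp_norm q b)))
   \<and> (1 < p \<and> p < \<infinity> \<and> p \<noteq> r \<longrightarrow>
        (\<forall>(z :: real ^ 'm) (b :: real ^ 'n).
          lp_norm p z + l / delta TYPE('m) r p * lp_norm q b \<le> robust_max l p q r z b) \<and>
        (\<forall>b :: real ^ 'n.
          (INF z :: real ^ 'm. robust_max l p q r z b
             - (lp_norm p z + l / delta TYPE('m) r p * lp_norm q b)) = 0))"
proof (intro conjI impI allI)
  have l: "0 \<le> l" using assms(1) by simp
  show "robust_max l p q r z b \<le> lp_norm p z + l * delta TYPE('m) p r * lp_norm q b"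
    for z :: "real ^ 'm" and b :: "real ^ 'n"
    by (rule robust_max_upper[OF l assms(2-4)])
  show "robust_max l p q r z b = lp_norm p z + l * delta TYPE('m) p r * lp_norm q b"
    if "p \<in> {1, r, \<infinity>}" for z :: "real ^ 'm" and b :: "real ^ 'n"
    by (rule robust_max_eq_upper[OF l assms(2-4) that])
  show "AE z :: real ^ 'm in lebesgue.
      robust_max l p q r z b < lp_norm p z + l * delta TYPE('m) p r * lp_norm q b"
    if "1 < p \<and> p < \<infinity> \<and> p \<noteq> r \<and> 2 \<le> CARD('m)" "b \<noteq> 0" for b :: "real ^ 'n"
    using that by (intro robust_max_strict_AE assms) auto
  show lower: "lp_norm p z + l / delta TYPE('m) r p * lp_norm q b \<le> robust_max l p q r z b"
    for z :: "real ^ 'm" and b :: "real ^ 'n"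
    by (rule robust_max_lower[OF l assms(2-4)])
  show "(INF z :: real ^ 'm. robust_max l p q r z b
      - (lp_norm p z + l / delta TYPE('m) r p * lp_norm q b)) = 0" (is "Inf (range ?gap) = 0")
    if p: "1 < p \<and> p < \<infinity> \<and> p \<noteq> r" for b :: "real ^ 'n"
  \<comment> \<open>The gaps are bounded below by 0 through \<open>lower\<close>, and
    \<open>robust_max_gap\<close> excludes every positive lower bound.\<close>
  proof (rule cInf_eq_non_empty)
    show "0 \<le> x" if "x \<in> range ?gap" for x using that lower[of _ b] by auto
    show "y \<le> 0" if y: "\<And>x. x \<in> range ?gap \<Longrightarrow> y \<le> x" for y
    proof (rule field_le_epsilon)
      fix e :: real assume "0 < e"
      then obtain z :: "real ^ 'm" where "?gap z \<le> e"
        using robust_max_gap[of l p q r e b] p l assms by (metis add.commute diff_le_eq)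
      then show "y \<le> 0 + e" using y[of "?gap z"] by simp
    qed
  qed simp
qed

end
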